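(* Let $T$ be an isometry acting on a complex Hilbert space $\mathcal{H}$ and let $x \in \mathcal{H}$. Suppose that $$\sum_{k=0}^\infty k \,\| T^{*k} x \| < \infty .$$ Then there exists $y \in \mathcal{H}$ such that $x = (I-T)y$ if and only if $$\lim_{n\to \infty} \frac{1}{n} \left\|\sum_{k= 0}^n T^k x \right\|^2 = 0 .$$
   Context: An isometry on $\mathcal{H}$ is a linear operator $T:\mathcal{H}\to\mathcal{H}$ with $\|Tu\|=\|u\|$ for all $u\in\mathcal{H}$ (not necessarily surjective). $T^*$ is the Hilbert space adjoint of $T$, $T^{*k}=(T^* )^k$, and $I$ is the identity operator. *)

theory Defs
  imports "HOL-Analysis.Analysis"
begin

class complex_vector = real_vector +
  fixes scaleC :: "complex \<Rightarrow> 'a \<Rightarrow> 'a"  (infixr \<open>*\<^sub>C\<close> 75)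
  assumes scaleC_add_right: "a *\<^sub>C (x + y) = a *\<^sub>C x + a *\<^sub>C y"
    and scaleC_add_left: "(a + b) *\<^sub>C x = a *\<^sub>C x + b *\<^sub>C x"
    and scaleC_scaleC: "a *\<^sub>C b *\<^sub>C x = (a * b) *\<^sub>C x"
    and scaleC_one: "1 *\<^sub>C x = x"
    and scaleR_scaleC: "r *\<^sub>R x = complex_of_real r *\<^sub>C x"

(* The inner product is linear in its first argument and conjugate-linear in its second.
   The axiom cinner_self says both that the form is positive definite and that the norm
   is the one it induces; the axioms of a real normed space are then consequences and
   only serve to make the library's norm, limits and series available. *)
class complex_inner = complex_vector + real_normed_vector +
  fixes cinner :: "'a \<Rightarrow> 'a \<Rightarrow> complex"
  assumes cinner_add_left: "cinner (x + y) z = cinner x z + cinner y z"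
    and cinner_scaleC_left: "cinner (a *\<^sub>C x) y = a * cinner x y"
    and cinner_commute: "cinner y x = cnj (cinner x y)"
    and cinner_self: "cinner x x = complex_of_real ((norm x)\<^sup>2)"

class chilbert_space = complex_inner + complete_space

instantiation complex :: chilbert_space
begin

definition "a *\<^sub>C (x :: complex) = a * x"

definition "cinner x (y :: complex) = x * cnj y"

instance
  by standard
    (auto simp: scaleC_complex_def cinner_complex_def algebra_simps scaleR_conv_of_real
      complex_norm_square[symmetric])

end

subclass (in chilbert_space) banach ..

global_interpretation complex_vector: vector_space "scaleC :: complex \<Rightarrow> 'a \<Rightarrow> 'a::complex_vector"
  by standard (simp_all add: scaleC_add_right scaleC_add_left scaleC_scaleC scaleC_one)

abbreviation clinear :: "('a::complex_vector \<Rightarrow> 'b::complex_vector) \<Rightarrow> bool"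
  where "clinear \<equiv> Vector_Spaces.linear scaleC scaleC"

definition isometry :: "('a::complex_inner \<Rightarrow> 'a) \<Rightarrow> bool"
  where "isometry T \<longleftrightarrow> clinear T \<and> (\<forall>u. norm (T u) = norm u)"

(* As with the library's real adjoint, the value is meaningful when an adjoint exists,
   which on a Hilbert space is the case for every bounded linear operator; cadjoint_unique
   shows that the choice is then the only possible one. *)
definition cadjoint :: "('a::complex_inner \<Rightarrow> 'b::complex_inner) \<Rightarrow> 'b \<Rightarrow> 'a"
  where "cadjoint T = (SOME S. \<forall>u v. cinner (T u) v = cinner u (S v))"

lemma cadjoint_unique:
  fixes T :: "'a::complex_inner \<Rightarrow> 'b::complex_inner"
  assumes S: "\<And>u v. cinner (T u) v = cinner u (S v)"
  shows "cadjoint T = S"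
proof -
  have ex: "\<forall>u v. cinner (T u) v = cinner u (cadjoint T v)"
    unfolding cadjoint_def by (rule someI[where x = S]) (simp add: S)
  show ?thesis
  proof
    fix v
    define d where "d = cadjoint T v - S v"
    have split: "cadjoint T v = d + S v"
      by (simp add: d_def)
    have "cinner (cadjoint T v) d = cinner (S v) d"
      by (metis S ex cinner_commute)
    then have "cinner d d = 0"
      by (simp add: split cinner_add_left)
    then show "cadjoint T v = S v"
      by (simp add: cinner_self d_def)
  qed
qed

end

theory Submission
  imports Defs
begin

text \<open>
  Put \<open>S\<^sub>n = (\<Sum>k\<le>n. T\<^sup>k x)\<close> and \<open>c\<^sub>d = Re \<langle>x, T\<^sup>*\<^sup>d x\<rangle>\<close>. As \<open>T\<close> is an isometry,
  \<open>\<parallel>S\<^sub>n\<parallel>\<^sup>2\<close> equals \<open>(n + 1) (\<parallel>x\<parallel>\<^sup>2 + 2 \<Sum>\<^sub>1\<^sub>\<le>\<^sub>d\<^sub>\<le>\<^sub>n c\<^sub>d) - 2 \<Sum>\<^sub>1\<^sub>\<le>\<^sub>d\<^sub>\<le>\<^sub>n d c\<^sub>d\<close>. Since \<open>\<Sum> d \<bar>c\<^sub>d\<bar> < \<infinity>\<close>,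
  \<open>\<parallel>S\<^sub>n\<parallel>\<^sup>2 / n\<close> converges, and when its limit is zero the sequence \<open>S\<^sub>n\<close> is even bounded.
  But \<open>S\<^sub>n\<close> is an orbit of the isometric affine map \<open>A y = x + T y\<close>, and the asymptotic center
  of a bounded orbit is a fixed point of \<open>A\<close>, that is, a solution of \<open>x = (I - T) y\<close>.
  Conversely, \<open>S\<^sub>n\<close> telescopes to \<open>y - T\<^sup>n\<^sup>+\<^sup>1 y\<close> for such a \<open>y\<close>.
\<close>

section \<open>Inner product identities\<close>

lemma cinner_add_right: "cinner x (y + z) = cinner x y + cinner x z"
  for x :: "'a::complex_inner"
  by (metis cinner_add_left cinner_commute complex_cnj_add)

lemma cinner_zero_left [simp]: "cinner 0 x = 0" for x :: "'a::complex_inner"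
  using cinner_add_left[of 0 0 x] by simp

lemma cinner_minus_left: "cinner (- x) y = - cinner x y" for x :: "'a::complex_inner"
  using cinner_add_left[of x "- x" y] by (simp add: eq_neg_iff_add_eq_0 add.commute)

lemma cinner_minus_right: "cinner x (- y) = - cinner x y" for x :: "'a::complex_inner"
  by (metis cinner_commute cinner_minus_left complex_cnj_minus)

lemma cinner_diff_right: "cinner x (y - z) = cinner x y - cinner x z"
  for x :: "'a::complex_inner"
  using cinner_add_right[of x y "- z"] by (simp add: cinner_minus_right)

lemma cinner_scaleR_left: "cinner (r *\<^sub>R x) y = of_real r * cinner x y"
  for x :: "'a::complex_inner"
  by (simp add: scaleR_scaleC cinner_scaleC_left)

lemma cinner_sum_left: "cinner (\<Sum>i\<in>A. f i) y = (\<Sum>i\<in>A. cinner (f i) y)"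
  for y :: "'a::complex_inner"
  by (induction A rule: infinite_finite_induct) (simp_all add: cinner_add_left)

lemma norm_add_square: "(norm (x + y))\<^sup>2 = (norm x)\<^sup>2 + 2 * Re (cinner x y) + (norm y)\<^sup>2"
  for x :: "'a::complex_inner"
proof -
  have "complex_of_real ((norm (x + y))\<^sup>2) =
      of_real ((norm x)\<^sup>2) + (cinner x y + cnj (cinner x y)) + of_real ((norm y)\<^sup>2)"
    unfolding cinner_self[symmetric] cinner_commute[of y x, symmetric]
    by (simp add: cinner_add_left cinner_add_right)
  also have "\<dots> = complex_of_real ((norm x)\<^sup>2 + 2 * Re (cinner x y) + (norm y)\<^sup>2)"
    by (simp add: complex_eq_iff)
  finally show ?thesis
    using of_real_eq_iff by blast
qed

text \<open>Parallelogram law for \<open>a - p\<close> and \<open>b - p\<close>. The term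
  \<open>(norm (a - b))\<^sup>2 / 4\<close> is the strong convexity behind both minimizations
  below.\<close>

lemma norm_midpoint_diff_square:
  fixes a b p :: "'a::complex_inner"
  shows "(norm ((1/2) *\<^sub>R (a + b) - p))\<^sup>2 =
    ((norm (a - p))\<^sup>2 + (norm (b - p))\<^sup>2) / 2 - (norm (a - b))\<^sup>2 / 4"
proof -
  have 1: "(1/2) *\<^sub>R (a + b) - p = (1/2) *\<^sub>R ((a - p) + (b - p))"
    by (simp add: algebra_simps scaleR_2[symmetric])
  have 2: "a - b = (a - p) + - (b - p)"
    by simp
  have "(norm (a - b))\<^sup>2 = (norm (a - p))\<^sup>2 - 2 * Re (cinner (a - p) (b - p)) + (norm (b - p))\<^sup>2"
    unfolding 2 norm_add_square cinner_minus_right norm_minus_cancel by simp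
  then show ?thesis
    unfolding 1 norm_scaleR power_mult_distrib norm_add_square by (simp add: field_simps)
qed

lemma cinner_bound_Re: "\<bar>Re (cinner x y)\<bar> \<le> norm x * norm y" for x :: "'a::complex_inner"
proof (cases "x = 0")
  case False
  \<comment> \<open>This \<open>t\<close> minimizes the quadratic
    \<open>(norm (t *\<^sub>R x + y))\<^sup>2\<close>; that the minimum is nonnegative is the
    Cauchy-Schwarz inequality.\<close>
  define t where "t = - Re (cinner x y) / (norm x)\<^sup>2"
  have "0 \<le> (norm (t *\<^sub>R x + y))\<^sup>2"
    by simp
  also have "\<dots> = (norm y)\<^sup>2 - (Re (cinner x y))\<^sup>2 / (norm x)\<^sup>2"
    using False unfolding norm_add_square cinner_scaleR_left t_def
    by (simp add: field_simps power2_eq_square)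
  finally have "(Re (cinner x y))\<^sup>2 \<le> (norm x * norm y)\<^sup>2"
    using False by (simp add: field_simps)
  then show ?thesis
    by (simp add: abs_le_square_iff[symmetric] abs_mult)
qed simp

section \<open>Minimizing strongly convex functionals\<close>

text \<open>The midpoint inequality controls the distance of two points by the excess of their
  values over the infimum. Hence minimizing sequences are Cauchy, \<open>lsc\<close> makes their
  limit a minimizer, and two minimizers coincide.\<close>

lemma midpoint_convex_minimizer:
  fixes f :: "'a::{real_normed_vector, complete_space} \<Rightarrow> real"
  assumes nonneg: "\<And>u. 0 \<le> f u"
    and midpoint: "\<And>a b. f ((1/2) *\<^sub>R (a + b)) \<le> (f a + f b) / 2 - (norm (a - b))\<^sup>2 / 4"
    and lsc: "\<And>u v m. u \<longlonglongrightarrow> v \<Longrightarrow> (\<lambda>k. f (u k)) \<longlonglongrightarrow> m \<Longrightarrow> f v \<le> m"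
  obtains v where "\<And>u. f v \<le> f u" "\<And>u. f u \<le> f v \<Longrightarrow> u = v"
proof -
  define m where "m = Inf (range f)"
  have bdd: "bdd_below (range f)"
    using nonneg by (auto intro: bdd_belowI[of _ 0])
  have m_le: "m \<le> f u" for u
    unfolding m_def by (rule cInf_lower[OF _ bdd]) simp
  have dist_le: "(norm (a - b))\<^sup>2 / 4 \<le> ((f a - m) + (f b - m)) / 2" for a b
    using order_trans[OF m_le midpoint[of a b]]
    unfolding add_divide_distrib diff_divide_distrib by linarith
  have "\<exists>u. f u < m + inverse (real (Suc k))" for k
    using cInf_lessD[of "range f" "m + inverse (real (Suc k))"] by (auto simp: m_def)
  then obtain u where u: "\<And>k. f (u k) < m + inverse (real (Suc k))"
    by metis
  have lim: "(\<lambda>k. m + inverse (real (Suc k))) \<longlonglongrightarrow> m"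
    using tendsto_add[OF tendsto_const LIMSEQ_inverse_real_of_nat, of m] by simp
  have fu: "(\<lambda>k. f (u k)) \<longlonglongrightarrow> m"
    by (rule tendsto_sandwich[OF _ _ tendsto_const lim])
      (intro always_eventually allI m_le less_imp_le[OF u])+
  have "Cauchy u"
  proof (rule metric_CauchyI)
    fix e :: real
    assume "0 < e"
    then have "m < m + e\<^sup>2 / 4"
      by simp
    then obtain N where N: "\<And>k. k \<ge> N \<Longrightarrow> f (u k) < m + e\<^sup>2 / 4"
      using order_tendstoD(2)[OF fu] unfolding eventually_sequentially by blast
    have "dist (u i) (u j) < e" if "i \<ge> N" "j \<ge> N" for i j
    proof -
      have "((f (u i) - m) + (f (u j) - m)) / 2 < e\<^sup>2 / 4"
        using N[OF that(1)] N[OF that(2)] by simp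
      then have "(norm (u i - u j))\<^sup>2 < e\<^sup>2"
        using order_le_less_trans[OF dist_le] by fastforce
      then show ?thesis
        using \<open>0 < e\<close> by (simp add: dist_norm power_less_imp_less_base)
    qed
    then show "\<exists>N. \<forall>i\<ge>N. \<forall>j\<ge>N. dist (u i) (u j) < e"
      by blast
  qed
  then obtain v where v: "u \<longlonglongrightarrow> v"
    unfolding Cauchy_convergent_iff convergent_def by blast
  have "f v \<le> m"
    using lsc[OF v fu] .
  show ?thesis
  proof
    show "f v \<le> f w" for w
      using \<open>f v \<le> m\<close> m_le[of w] by linarith
    show "w = v" if "f w \<le> f v" for w
    proof -
      have "(norm (w - v))\<^sup>2 / 4 \<le> 0"
        by (rule order_trans[OF dist_le]) (use that \<open>f v \<le> m\<close> in simp)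
      then show ?thesis
        by simp
    qed
  qed
qed

section \<open>Isometries and their adjoints\<close>

lemma isometry_add: "isometry T \<Longrightarrow> T (u + v) = T u + T v"
  by (simp add: isometry_def Vector_Spaces.linear_iff)

lemma isometry_scaleC: "isometry T \<Longrightarrow> T (a *\<^sub>C u) = a *\<^sub>C T u"
  by (simp add: isometry_def Vector_Spaces.linear_iff)

lemma isometry_norm: "isometry T \<Longrightarrow> norm (T u) = norm u"
  by (simp add: isometry_def)

lemma isometry_linear: "isometry T \<Longrightarrow> linear T"
  by (intro linearI) (simp_all add: isometry_add isometry_scaleC scaleR_scaleC)

lemma isometry_bounded_linear: "isometry T \<Longrightarrow> bounded_linear T"
  by (intro bounded_linear_intro[where K = 1])
    (simp_all add: isometry_norm linear_add[OF isometry_linear] linear_scale[OF isometry_linear])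

text \<open>Polarization: the real part is determined by the norms of \<open>u\<close>,
  \<open>v\<close> and \<open>u + v\<close>.\<close>

lemma isometry_Re_cinner: "isometry T \<Longrightarrow> Re (cinner (T u) (T v)) = Re (cinner u v)"
  using norm_add_square[of "T u" "T v"] norm_add_square[of u v]
  by (simp add: isometry_add[symmetric] isometry_norm)

lemma norm_funpow_isometry: "isometry T \<Longrightarrow> norm ((T ^^ k) u) = norm u"
  by (induction k) (simp_all add: isometry_norm)

text \<open>First-order condition: the best \<open>t\<close> lowers the square by
  \<open>(Re (cinner w v))\<^sup>2 / (norm w)\<^sup>2\<close>, which minimality forbids unless it is
  zero.\<close>

lemma Re_cinner_eq_0_if_minimal:
  fixes v w :: "'a::complex_inner"
  assumes "\<And>t::real. (norm v)\<^sup>2 \<le> (norm (t *\<^sub>R w + v))\<^sup>2"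
  shows "Re (cinner w v) = 0"
proof (cases "w = 0")
  case False
  define t where "t = - Re (cinner w v) / (norm w)\<^sup>2"
  have "(norm v)\<^sup>2 \<le> (norm (t *\<^sub>R w + v))\<^sup>2"
    by (rule assms)
  also have "\<dots> = (norm v)\<^sup>2 - (Re (cinner w v))\<^sup>2 / (norm w)\<^sup>2"
    using False unfolding norm_add_square cinner_scaleR_left t_def
    by (simp add: field_simps power2_eq_square)
  finally have "(Re (cinner w v))\<^sup>2 \<le> 0"
    using False by (simp add: field_simps)
  then show ?thesis
    by simp
qed simp

text \<open>
  The value \<open>T\<^sup>* v\<close> is the coordinate of the point of the range of \<open>T\<close> nearest to \<open>v\<close>.
\<close>

lemma isometry_Re_adjoint_ex:
  fixes T :: "'a::chilbert_space \<Rightarrow> 'a"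
  assumes "isometry T"
  shows "\<exists>w. \<forall>u. Re (cinner (T u) v) = Re (cinner u w)"
proof -
  interpret T: bounded_linear T
    using assms by (rule isometry_bounded_linear)
  define f where "f u = (norm (T u - v))\<^sup>2" for u
  obtain w where w: "\<And>u. f w \<le> f u"
  proof (rule midpoint_convex_minimizer[of f])
    show "0 \<le> f u" for u
      by (simp add: f_def)
    show "f ((1/2) *\<^sub>R (a + b)) \<le> (f a + f b) / 2 - (norm (a - b))\<^sup>2 / 4" for a b
      unfolding f_def T.scaleR T.add norm_midpoint_diff_square T.diff[symmetric]
        isometry_norm[OF assms] by simp
    show "f p \<le> m" if "u \<longlonglongrightarrow> p" "(\<lambda>k. f (u k)) \<longlonglongrightarrow> m" for u p m
    proof -
      have "(\<lambda>k. f (u k)) \<longlonglongrightarrow> f p"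
        unfolding f_def by (intro tendsto_intros T.tendsto that(1))
      then show ?thesis
        using LIMSEQ_unique[OF that(2)] by simp
    qed
  qed blast
  have "Re (cinner (T u) v) = Re (cinner u w)" for u
  proof -
    \<comment> \<open>The residual of the nearest point is orthogonal to the range of
      \<open>T\<close>.\<close>
    have "Re (cinner (T u) (T w - v)) = 0"
    proof (rule Re_cinner_eq_0_if_minimal)
      show "(norm (T w - v))\<^sup>2 \<le> (norm (t *\<^sub>R T u + (T w - v)))\<^sup>2" for t
        using w[of "t *\<^sub>R u + w"] by (simp add: f_def T.add T.scaleR algebra_simps)
    qed
    then show ?thesis
      by (simp add: cinner_diff_right isometry_Re_cinner[OF assms])
  qed
  then show ?thesis
    by blast
qed

lemma cinner_cadjoint_isometry:
  fixes T :: "'a::chilbert_space \<Rightarrow> 'a"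
  assumes "isometry T"
  shows "cinner (T u) v = cinner u (cadjoint T v)"
proof -
  obtain S where S: "\<And>u v. Re (cinner (T u) v) = Re (cinner u (S v))"
    using isometry_Re_adjoint_ex[OF assms] by metis
  \<comment> \<open>Since \<open>Re (\<i> * c) = - Im c\<close>, replacing \<open>u\<close> by
    \<open>\<i> *\<^sub>C u\<close> carries the identity over to imaginary parts.\<close>
  have "Im (cinner (T u) v) = Im (cinner u (S v))" for u v
    using S[of "\<i> *\<^sub>C u" v] by (simp add: isometry_scaleC[OF assms] cinner_scaleC_left)
  then have adj: "cinner (T u) v = cinner u (S v)" for u v
    using S by (simp add: complex_eq_iff)
  then have "cadjoint T = S"
    by (rule cadjoint_unique)
  then show ?thesis
    by (simp add: adj)
qed

lemma cinner_funpow_cadjoint_isometry: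
  fixes T :: "'a::chilbert_space \<Rightarrow> 'a"
  assumes "isometry T"
  shows "cinner ((T ^^ k) u) v = cinner u ((cadjoint T ^^ k) v)"
  by (induction k arbitrary: v)
    (simp_all add: cinner_cadjoint_isometry[OF assms] funpow_swap1[of "cadjoint T"])

section \<open>Norms of orbit sums\<close>

lemma orbit_sum_Suc:
  fixes T :: "'a::complex_inner \<Rightarrow> 'a"
  assumes "isometry T"
  shows "(\<Sum>k=0..Suc n. (T ^^ k) x) = x + T (\<Sum>k=0..n. (T ^^ k) x)"
  by (simp add: linear_sum[OF isometry_linear[OF assms]] sum.atLeast0_atMost_Suc_shift
      del: sum.cl_ivl_Suc)

text \<open>Expanding the square, a pair of exponents contributes according to its difference
  \<open>d\<close>, which occurs \<open>n + 1 - d\<close> times in each order; the two orders give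
  the factor 2 for \<open>d > 0\<close>. In the induction, passing to \<open>Suc n\<close> adds the
  sum of \<open>b d\<close> over \<open>d \<le> Suc n\<close>.\<close>

lemma norm_orbit_sum_square:
  fixes T :: "'a::complex_inner \<Rightarrow> 'a"
  assumes "isometry T"
    and b: "\<And>d. b d = (if d = 0 then 1 else 2) * Re (cinner ((T ^^ d) x) x)"
  shows "(norm (\<Sum>k=0..n. (T ^^ k) x))\<^sup>2 = real (Suc n) * (\<Sum>d\<le>n. b d) - (\<Sum>d\<le>n. real d * b d)"
proof (induction n)
  case 0
  then show ?case
    by (simp add: b cinner_self)
next
  case (Suc n)
  have "(norm (\<Sum>k=0..Suc n. (T ^^ k) x))\<^sup>2 =
      (norm x)\<^sup>2 + 2 * Re (cinner (T (\<Sum>k=0..n. (T ^^ k) x)) x) + (norm (\<Sum>k=0..n. (T ^^ k) x))\<^sup>2"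
    unfolding orbit_sum_Suc[OF assms(1)] add.commute[of x] norm_add_square isometry_norm[OF assms(1)]
    by simp
  also have "2 * Re (cinner (T (\<Sum>k=0..n. (T ^^ k) x)) x) = (\<Sum>k\<le>n. b (Suc k))"
    by (simp add: linear_sum[OF isometry_linear[OF assms(1)]] cinner_sum_left b sum_distrib_left
        atMost_atLeast0)
  also have "(norm x)\<^sup>2 + (\<Sum>k\<le>n. b (Suc k)) = (\<Sum>d\<le>Suc n. b d)"
    unfolding sum.atMost_Suc_shift by (simp add: b cinner_self)
  finally show ?case
    unfolding Suc.IH by (simp add: algebra_simps)
qed

lemma summable_of_summable_index_mult:
  fixes f :: "nat \<Rightarrow> real"
  assumes "summable (\<lambda>k. real k * \<bar>f k\<bar>)"
  shows "summable (\<lambda>k. \<bar>f k\<bar>)"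
proof (rule summable_comparison_test_ev[OF _ assms])
  show "\<forall>\<^sub>F k in sequentially. norm \<bar>f k\<bar> \<le> real k * \<bar>f k\<bar>"
    using eventually_ge_at_top[of 1]
  proof eventually_elim
    case (elim k)
    then have "1 * \<bar>f k\<bar> \<le> real k * \<bar>f k\<bar>"
      by (intro mult_right_mono) auto
    then show ?case
      by simp
  qed
qed

text \<open>
  The vanishing limit forces the total sum of \<open>b\<close> to be zero, so that the first term below is
  \<open>n + 1\<close> times a tail of \<open>\<Sum> b\<^sub>d\<close>, which \<open>\<Sum> d \<bar>b\<^sub>d\<bar>\<close> dominates.
\<close>

lemma bounded_of_mean_tendsto_0:
  fixes b :: "nat \<Rightarrow> real"
  defines "s \<equiv> \<lambda>n. real (Suc n) * (\<Sum>d\<le>n. b d) - (\<Sum>d\<le>n. real d * b d)"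
  assumes sum_kb: "summable (\<lambda>k. real k * \<bar>b k\<bar>)"
    and lim: "(\<lambda>n. (1 / real n) * s n) \<longlonglongrightarrow> 0"
  shows "s n \<le> 2 * (\<Sum>k. real k * \<bar>b k\<bar>)"
proof -
  let ?M = "\<Sum>k. real k * \<bar>b k\<bar>"
  have sum_abs_b: "summable (\<lambda>k. \<bar>b k\<bar>)"
    using sum_kb by (rule summable_of_summable_index_mult)
  then have sum_b: "summable b"
    by (rule summable_rabs_cancel)
  have sum_kb': "summable (\<lambda>k. real k * b k)"
    by (rule summable_rabs_cancel) (use sum_kb in \<open>simp add: abs_mult\<close>)
  \<comment> \<open>The weighted sums converge, so dividing them by \<open>n\<close> leaves only the
    total sum of \<open>b\<close> in the limit.\<close>
  have "(\<lambda>n. (real (Suc n) / real n) * (\<Sum>d\<le>n. b d) - (1 / real n) * (\<Sum>d\<le>n. real d * b d))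
      \<longlonglongrightarrow> 1 * suminf b - 0 * (\<Sum>k. real k * b k)"
    by (intro tendsto_intros LIMSEQ_Suc_n_over_n lim_1_over_n
        summable_LIMSEQ'[OF sum_b] summable_LIMSEQ'[OF sum_kb'])
  then have "(\<lambda>n. (1 / real n) * s n) \<longlonglongrightarrow> suminf b"
    by (simp add: s_def right_diff_distrib)
  then have "suminf b = 0"
    using LIMSEQ_unique lim by blast
  then have tail: "(\<Sum>d\<le>n. b d) = - (\<Sum>k. b (k + Suc n))"
    using suminf_split_initial_segment[OF sum_b, of "Suc n"] by (simp add: lessThan_Suc_atMost)
  have sum_shift: "summable (\<lambda>k. real (k + Suc n) * \<bar>b (k + Suc n)\<bar>)"
    using summable_ignore_initial_segment[OF sum_kb, of "Suc n"] .
  have "real (Suc n) * (\<Sum>d\<le>n. b d) \<le> real (Suc n) * (\<Sum>k. \<bar>b (k + Suc n)\<bar>)"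
    unfolding tail using summable_rabs[OF summable_ignore_initial_segment[OF sum_abs_b, of "Suc n"]]
    by (intro mult_left_mono) auto
  also have "\<dots> = (\<Sum>k. real (Suc n) * \<bar>b (k + Suc n)\<bar>)"
    by (intro suminf_mult[symmetric] summable_ignore_initial_segment sum_abs_b)
  also have "\<dots> \<le> (\<Sum>k. real (k + Suc n) * \<bar>b (k + Suc n)\<bar>)"
    by (intro suminf_le summable_mult summable_ignore_initial_segment sum_abs_b sum_shift
        mult_right_mono) auto
  also have "\<dots> \<le> ?M"
    using suminf_split_initial_segment[OF sum_kb, of "Suc n"]
    by (simp add: sum_nonneg del: sum.lessThan_Suc)
  finally have first: "real (Suc n) * (\<Sum>d\<le>n. b d) \<le> ?M" .
  have "- (\<Sum>d\<le>n. real d * b d) \<le> (\<Sum>d\<le>n. real d * \<bar>b d\<bar>)"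
    unfolding sum_negf[symmetric] mult_minus_right[symmetric]
    by (intro sum_mono mult_left_mono) auto
  also have "\<dots> \<le> ?M"
    by (intro sum_le_suminf sum_kb) auto
  finally show ?thesis
    using first unfolding s_def by linarith
qed

section \<open>Fixed points of isometric affine maps\<close>

text \<open>The infimum below is \<open>limsup \<parallel>y - z\<^sub>n\<parallel>\<^sup>2\<close>; its minimizer is the asymptotic center of \<open>z\<close>.\<close>

lemma nonexpansive_fixed_point_of_bounded_orbit:
  fixes A :: "'a::chilbert_space \<Rightarrow> 'a"
  assumes nonexpansive: "\<And>u v. norm (A u - A v) \<le> norm (u - v)"
    and orbit: "\<And>n. z (Suc n) = A (z n)"
    and bounded: "\<And>n. (norm (z n))\<^sup>2 \<le> M"
  obtains y where "A y = y"
proof -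
  define E where "E y = {c. \<forall>\<^sub>F n in sequentially. (norm (y - z n))\<^sup>2 \<le> c}" for y
  define r where "r y = Inf (E y)" for y
  have E_nonneg: "0 \<le> c" if "c \<in> E y" for c y
  proof -
    obtain n where "(norm (y - z n))\<^sup>2 \<le> c"
      using \<open>c \<in> E y\<close> by (auto simp: E_def eventually_sequentially)
    then show ?thesis
      using zero_le_power2 order_trans by blast
  qed
  then have r_le: "r y \<le> c" if "c \<in> E y" for c y
    unfolding r_def using that by (intro cInf_lower bdd_belowI)
  have E_nonempty: "E y \<noteq> {}" for y
  proof -
    have "(norm (y - z n))\<^sup>2 \<le> (norm y + sqrt M)\<^sup>2" for n
    proof (rule power_mono)
      show "norm (y - z n) \<le> norm y + sqrt M"
        using norm_triangle_ineq4[of y "z n"] real_le_rsqrt[OF bounded[of n]] by linarith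
    qed simp
    then have "(norm y + sqrt M)\<^sup>2 \<in> E y"
      by (simp add: E_def)
    then show ?thesis
      by blast
  qed
  have r_nonneg: "0 \<le> r y" for y
    unfolding r_def by (intro cInf_greatest E_nonempty E_nonneg)
  \<comment> \<open>The infimum \<open>r y\<close> need not itself be an eventual bound, hence the
    slack \<open>e\<close> here and below.\<close>
  have ev: "\<forall>\<^sub>F n in sequentially. (norm (y - z n))\<^sup>2 \<le> r y + e" if "e > 0" for y e
  proof -
    obtain c where "c \<in> E y" "c < r y + e"
      using cInf_lessD[OF E_nonempty, of y "r y + e"] \<open>e > 0\<close> by (auto simp: r_def)
    then show ?thesis
      unfolding E_def by (auto elim: eventually_mono)
  qed
  obtain y where y: "\<And>u. r u \<le> r y \<Longrightarrow> u = y"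
  proof (rule midpoint_convex_minimizer[of r])
    show "0 \<le> r u" for u
      by (rule r_nonneg)
    show "r ((1/2) *\<^sub>R (a + b)) \<le> (r a + r b) / 2 - (norm (a - b))\<^sup>2 / 4" for a b
    proof (rule field_le_epsilon)
      fix e :: real
      assume "e > 0"
      have "\<forall>\<^sub>F n in sequentially. (norm ((1/2) *\<^sub>R (a + b) - z n))\<^sup>2 \<le>
          (r a + r b) / 2 - (norm (a - b))\<^sup>2 / 4 + e"
        using ev[OF \<open>e > 0\<close>, of a] ev[OF \<open>e > 0\<close>, of b]
      proof eventually_elim
        case (elim n)
        then show ?case
          unfolding norm_midpoint_diff_square add_divide_distrib by linarith
      qed
      then show "r ((1/2) *\<^sub>R (a + b)) \<le> (r a + r b) / 2 - (norm (a - b))\<^sup>2 / 4 + e"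
        by (intro r_le) (simp add: E_def)
    qed
    show "r v \<le> m" if u: "u \<longlonglongrightarrow> v" and ru: "(\<lambda>k. r (u k)) \<longlonglongrightarrow> m" for u v m
    proof (rule field_le_epsilon)
      fix e :: real
      assume "e > 0"
      have m_nonneg: "0 \<le> m"
        by (rule LIMSEQ_le_const[OF ru]) (use r_nonneg in auto)
      \<comment> \<open>Triangle inequality through \<open>u k\<close>, for each fixed
        \<open>k\<close>; letting \<open>k\<close> tend to infinity then gives
        semicontinuity.\<close>
      have "r v \<le> (norm (v - u k) + sqrt (r (u k) + e))\<^sup>2" for k
      proof (rule r_le, unfold E_def mem_Collect_eq)
        show "\<forall>\<^sub>F n in sequentially. (norm (v - z n))\<^sup>2 \<le> (norm (v - u k) + sqrt (r (u k) + e))\<^sup>2"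
          using ev[OF \<open>e > 0\<close>, of "u k"]
        proof eventually_elim
          case (elim n)
          have "norm (v - z n) \<le> norm (v - u k) + norm (u k - z n)"
            using norm_triangle_ineq[of "v - u k" "u k - z n"] by simp
          then show ?case
            using real_le_rsqrt[OF elim] by (intro power_mono) auto
        qed
      qed
      moreover have "(\<lambda>k. (norm (v - u k) + sqrt (r (u k) + e))\<^sup>2)
          \<longlonglongrightarrow> (norm (v - v) + sqrt (m + e))\<^sup>2"
        by (intro tendsto_intros u ru)
      ultimately have "r v \<le> (norm (v - v) + sqrt (m + e))\<^sup>2"
        by (intro LIMSEQ_le_const) auto
      then show "r v \<le> m + e"
        using m_nonneg \<open>e > 0\<close> by simp
    qed
  qed blast
  \<comment> \<open>\<open>A\<close> brings \<open>y\<close> and \<open>z n\<close> no further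
    apart, and the upper limit ignores the index shift. So \<open>A y\<close> is also a minimizer,
    and uniqueness gives \<open>A y = y\<close>.\<close>
  have "r (A y) \<le> r y"
  proof (rule field_le_epsilon)
    fix e :: real
    assume "e > 0"
    have "\<forall>\<^sub>F n in sequentially. (norm (A y - z (Suc n)))\<^sup>2 \<le> r y + e"
      using ev[OF \<open>e > 0\<close>, of y]
    proof eventually_elim
      case (elim n)
      have "(norm (A y - z (Suc n)))\<^sup>2 \<le> (norm (y - z n))\<^sup>2"
        unfolding orbit by (intro power_mono nonexpansive) simp
      then show ?case
        using elim by linarith
    qed
    then show "r (A y) \<le> r y + e"
      by (intro r_le)
        (simp add: E_def eventually_sequentially_Suc[of "\<lambda>n. (norm (A y - z n))\<^sup>2 \<le> r y + e"])
  qed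
  then show ?thesis
    using y that by blast
qed

lemma orbit_sum_telescope:
  fixes T :: "'a::complex_inner \<Rightarrow> 'a"
  assumes "isometry T" and "x = y - T y"
  shows "(\<Sum>k=0..n. (T ^^ k) x) = y - (T ^^ Suc n) y"
proof (induction n)
  case (Suc n)
  show ?case
    unfolding orbit_sum_Suc[OF assms(1)] Suc.IH linear_diff[OF isometry_linear[OF assms(1)]]
    by (simp add: assms(2))
qed (simp add: assms(2))

theorem theorem1p4:
  fixes T :: "'a::chilbert_space \<Rightarrow> 'a" and x :: 'a
  assumes "isometry T"
    and "summable (\<lambda>k. real k * norm ((cadjoint T ^^ k) x))"
  shows "(\<exists>y. x = (id - T) y) \<longleftrightarrow>
    (\<lambda>n. (1 / real n) * (norm (\<Sum>k=0..n. (T ^^ k) x))\<^sup>2) \<longlonglongrightarrow> 0"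
proof
  assume "\<exists>y. x = (id - T) y"
  then obtain y where y: "x = y - T y"
    by auto
  \<comment> \<open>The bound is uniform in \<open>n\<close> because powers of \<open>T\<close>
    preserve the norm of \<open>y\<close>.\<close>
  have bound: "(norm (\<Sum>k=0..n. (T ^^ k) x))\<^sup>2 \<le> (norm y + norm y)\<^sup>2" for n
    unfolding orbit_sum_telescope[OF assms(1) y]
    using norm_triangle_ineq4[of y "(T ^^ Suc n) y"]
    by (intro power_mono) (simp_all only: norm_funpow_isometry[OF assms(1)] norm_ge_zero)
  have "(\<lambda>n. (1 / real n) * (norm y + norm y)\<^sup>2) \<longlonglongrightarrow> 0"
    by (intro tendsto_mult_left_zero lim_1_over_n)
  then show "(\<lambda>n. (1 / real n) * (norm (\<Sum>k=0..n. (T ^^ k) x))\<^sup>2) \<longlonglongrightarrow> 0"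
    by (rule tendsto_sandwich[OF _ _ tendsto_const, rotated 2])
      (intro always_eventually allI mult_left_mono bound mult_nonneg_nonneg; simp)+
next
  define z where "z n = (\<Sum>k=0..n. (T ^^ k) x)" for n
  assume "(\<lambda>n. (1 / real n) * (norm (\<Sum>k=0..n. (T ^^ k) x))\<^sup>2) \<longlonglongrightarrow> 0"
  then have lim: "(\<lambda>n. (1 / real n) * (norm (z n))\<^sup>2) \<longlonglongrightarrow> 0"
    by (simp add: z_def)
  define b where "b d = (if d = 0 then 1 else 2) * Re (cinner ((T ^^ d) x) x)" for d :: nat
  note norm_z = norm_orbit_sum_square[OF assms(1) b_def, folded z_def]
  have "summable (\<lambda>k. real k * \<bar>b k\<bar>)"
  proof (rule summable_comparison_test')
    show "summable (\<lambda>k. 2 * norm x * (real k * norm ((cadjoint T ^^ k) x)))"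
      by (intro summable_mult assms(2))
    show "norm (real k * \<bar>b k\<bar>) \<le> 2 * norm x * (real k * norm ((cadjoint T ^^ k) x))" for k
    proof -
      \<comment> \<open>Moving \<open>T ^^ k\<close> to the other argument as a power of the adjoint
        lets Cauchy-Schwarz bring in the terms of the summability hypothesis.\<close>
      have "\<bar>b k\<bar> \<le> 2 * \<bar>Re (cinner ((T ^^ k) x) x)\<bar>"
        by (simp add: b_def abs_mult)
      also have "\<dots> \<le> 2 * (norm x * norm ((cadjoint T ^^ k) x))"
        unfolding cinner_funpow_cadjoint_isometry[OF assms(1)]
        by (intro mult_left_mono cinner_bound_Re) simp
      finally have "real k * \<bar>b k\<bar> \<le> real k * (2 * (norm x * norm ((cadjoint T ^^ k) x)))"
        by (intro mult_left_mono) simp_all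
      then show ?thesis
        by (simp add: mult_ac)
    qed
  qed
  then have bound: "(norm (z n))\<^sup>2 \<le> 2 * (\<Sum>k. real k * \<bar>b k\<bar>)" for n
    unfolding norm_z using lim[unfolded norm_z] by (rule bounded_of_mean_tendsto_0)
  obtain y where "x + T y = y"
  proof (rule nonexpansive_fixed_point_of_bounded_orbit[of "\<lambda>y. x + T y" z])
    show "norm (x + T u - (x + T v)) \<le> norm (u - v)" for u v
      by (simp add: linear_diff[OF isometry_linear[OF assms(1)], symmetric] isometry_norm[OF assms(1)])
    show "z (Suc n) = x + T (z n)" for n
      unfolding z_def by (rule orbit_sum_Suc[OF assms(1)])
  qed (use bound in auto)
  then have "x = (id - T) y"
    by (simp add: eq_diff_eq)
  then show "\<exists>y. x = (id - T) y" ..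
qed

end
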